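(* The geodesic connective constants of the square grid $\mathbb{Z}^2$, the ladder graph $\mathbb{L}$ and the hexagonal grid $\mathbb{H}$ are as follows: \begin{itemize} \item $\mu^g(\mathbb{Z}^2)=2$, \item $\mu^g(\mathbb{L})=1$, \item $\mu^g(\mathbb{H})=\sqrt{2}$. \end{itemize}
   Context: For a finitely generated group $G$ with finite symmetric generating set $S$ (not containing the identity), a word $w\in S^*$ is a geodesic if no shorter word over $S$ represents the same group element; $\mathrm{Geo}(G,S)$ is the set of geodesics. The geodesic growth function is $\Gamma_{G,S}(n)=|\{w\in\mathrm{Geo}(G,S):|w|\le n\}|$, and the geodesic connective constant of the Cayley graph of $(G,S)$ is $\mu^g(G,S)=\lim_{n\to\infty}\sqrt[n]{\Gamma_{G,S}(n)}$. The square grid is the Cayley graph of $\mathbb{Z}^2$ with its standard generators $\{a^{\pm1},b^{\pm1}\}$. The ladder graph $\mathbb{L}$ is the Cayley graph of $\mathbb{Z}\times\mathbb{Z}/2\mathbb{Z}=\langle t,s\mid s^2, tst^{-1}s\rangle$ with generators $\{t^{\pm1},s\}$. The hexagonal grid $\mathbb{H}$ is the Cayley graph of the affine Coxeter group $\tilde{A}_2=\langle a,b,c\mid a^2,b^2,c^2,(ab)^3,(ac)^3,(bc)^3\rangle$ with generators $\{a,b,c\}$. *)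

theory Defs
  imports "HOL-Analysis.Analysis" "HOL-Algebra.Elementary_Groups"
begin

section \<open>Geodesic growth of a group with respect to a finite generating set\<close>

definition symmetric_generating_set :: "('g, 'm) monoid_scheme \<Rightarrow> 'g set \<Rightarrow> bool" where
  "symmetric_generating_set G S \<longleftrightarrow>
     finite S \<and> S \<subseteq> carrier G \<and> (\<forall>x\<in>S. inv\<^bsub>G\<^esub> x \<in> S) \<and> \<one>\<^bsub>G\<^esub> \<notin> S \<and> generate G S = carrier G"

definition word_value :: "('g, 'm) monoid_scheme \<Rightarrow> 'g list \<Rightarrow> 'g" where
  "word_value G w = foldr (\<otimes>\<^bsub>G\<^esub>) w \<one>\<^bsub>G\<^esub>"

definition geodesics :: "('g, 'm) monoid_scheme \<Rightarrow> 'g set \<Rightarrow> 'g list set" where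
  "geodesics G S = {w \<in> lists S. \<not> (\<exists>v \<in> lists S. length v < length w \<and> word_value G v = word_value G w)}"

definition geodesic_growth :: "('g, 'm) monoid_scheme \<Rightarrow> 'g set \<Rightarrow> nat \<Rightarrow> nat" where
  "geodesic_growth G S n = card {w \<in> geodesics G S. length w \<le> n}"

definition geodesic_root :: "('g, 'm) monoid_scheme \<Rightarrow> 'g set \<Rightarrow> nat \<Rightarrow> real" where
  "geodesic_root G S n = root n (real (geodesic_growth G S n))"

text \<open>As usual for \<^const>\<open>lim\<close>, this is meaningful only where \<^const>\<open>geodesic_root\<close> converges.\<close>

definition geodesic_connective_constant :: "('g, 'm) monoid_scheme \<Rightarrow> 'g set \<Rightarrow> real" where
  "geodesic_connective_constant G S = lim (geodesic_root G S)"


section \<open>Group presentations\<close>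

text \<open>
  The group with the type \<open>'x\<close> as generators and the words in \<open>R\<close> as relators. A letter
  \<open>(x, False)\<close> stands for the generator \<open>x\<close> and \<open>(x, True)\<close> for its formal inverse. Two words are
  identified iff they differ by finitely many insertions and deletions of relators and of adjacent
  mutually inverse letters.
\<close>

inductive pres_eq :: "('x \<times> bool) list set \<Rightarrow> ('x \<times> bool) list \<Rightarrow> ('x \<times> bool) list \<Rightarrow> bool"
  for R :: "('x \<times> bool) list set" where
  refl: "pres_eq R u u"
| sym: "pres_eq R u v \<Longrightarrow> pres_eq R v u"
| trans: "pres_eq R u v \<Longrightarrow> pres_eq R v w \<Longrightarrow> pres_eq R u w"
| cancel: "pres_eq R (u @ [(x, e), (x, \<not> e)] @ v) (u @ v)"
| relator: "r \<in> R \<Longrightarrow> pres_eq R (u @ r @ v) (u @ v)"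

definition pres_class :: "('x \<times> bool) list set \<Rightarrow> ('x \<times> bool) list \<Rightarrow> ('x \<times> bool) list set" where
  "pres_class R u = {v. pres_eq R u v}"

definition presented_group :: "('x \<times> bool) list set \<Rightarrow> ('x \<times> bool) list set monoid" where
  "presented_group R =
     \<lparr>carrier = range (pres_class R),
      monoid.mult = (\<lambda>P Q. {w. \<exists>u\<in>P. \<exists>v\<in>Q. pres_eq R (u @ v) w}),
      one = pres_class R []\<rparr>"

definition pres_gen :: "('x \<times> bool) list set \<Rightarrow> 'x \<Rightarrow> ('x \<times> bool) list set" where
  "pres_gen R x = pres_class R [(x, False)]"

lemma pres_class_eq_iff: "pres_class R u = pres_class R v \<longleftrightarrow> pres_eq R u v"
  unfolding pres_class_def by (auto intro: pres_eq.intros)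

lemma pres_eq_append_left: "pres_eq R u v \<Longrightarrow> pres_eq R (p @ u) (p @ v)"
proof (induction rule: pres_eq.induct)
  case (cancel u x e v)
  then show ?case using pres_eq.cancel[of R "p @ u" x e v] by simp
next
  case (relator r u v)
  then show ?case using pres_eq.relator[of r R "p @ u" v] by simp
qed (blast intro: pres_eq.intros)+

lemma pres_eq_append_right: "pres_eq R u v \<Longrightarrow> pres_eq R (u @ q) (v @ q)"
proof (induction rule: pres_eq.induct)
  case (cancel u x e v)
  then show ?case using pres_eq.cancel[of R u x e "v @ q"] by simp
next
  case (relator r u v)
  then show ?case using pres_eq.relator[of r R u "v @ q"] by simp
qed (blast intro: pres_eq.intros)+

lemma pres_eq_append:
  assumes "pres_eq R u u'" "pres_eq R v v'"
  shows "pres_eq R (u @ v) (u' @ v')"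
  using pres_eq.trans[OF pres_eq_append_right[OF assms(1)] pres_eq_append_left[OF assms(2)]] .

lemma carrier_presented_group: "carrier (presented_group R) = range (pres_class R)"
  by (simp add: presented_group_def)

lemma one_presented_group: "\<one>\<^bsub>presented_group R\<^esub> = pres_class R []"
  by (simp add: presented_group_def)

lemma mult_presented_group:
  "pres_class R u \<otimes>\<^bsub>presented_group R\<^esub> pres_class R v = pres_class R (u @ v)"
proof -
  have "(\<exists>u'\<in>pres_class R u. \<exists>v'\<in>pres_class R v. pres_eq R (u' @ v') w) \<longleftrightarrow> pres_eq R (u @ v) w" for w
    unfolding pres_class_def
    by (auto intro: pres_eq.refl pres_eq.trans pres_eq_append)
  then show ?thesis
    by (simp add: presented_group_def pres_class_def)
qed

lemma pres_eq_inverse: "pres_eq R (map (\<lambda>(x, e). (x, \<not> e)) (rev u) @ u) []"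
proof (induction u)
  case Nil
  then show ?case by (simp add: pres_eq.refl)
next
  case (Cons l u)
  obtain x e where l: "l = (x, e)" by (cases l)
  show ?case
    using pres_eq.trans[OF pres_eq.cancel[of R "map (\<lambda>(x, e). (x, \<not> e)) (rev u)" x "\<not> e" u] Cons.IH]
    by (simp add: l)
qed

lemma group_presented_group: "group (presented_group R)"
proof (rule groupI)
  fix X assume "X \<in> carrier (presented_group R)"
  then obtain u where X: "X = pres_class R u" by (auto simp: carrier_presented_group)
  show "\<one>\<^bsub>presented_group R\<^esub> \<otimes>\<^bsub>presented_group R\<^esub> X = X"
    by (simp add: X one_presented_group mult_presented_group)
  show "\<exists>Y\<in>carrier (presented_group R). Y \<otimes>\<^bsub>presented_group R\<^esub> X = \<one>\<^bsub>presented_group R\<^esub>"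
  proof (rule bexI)
    show "pres_class R (map (\<lambda>(x, e). (x, \<not> e)) (rev u)) \<in> carrier (presented_group R)"
      unfolding carrier_presented_group by (rule rangeI)
  qed (simp add: X one_presented_group mult_presented_group pres_class_eq_iff pres_eq_inverse)
qed (auto simp: carrier_presented_group one_presented_group mult_presented_group)


section \<open>The three Cayley graphs\<close>

definition square_grid_group :: "(int \<times> int) monoid" where
  "square_grid_group = integer_group \<times>\<times> integer_group"

definition square_grid_gens :: "(int \<times> int) set" where
  "square_grid_gens = {(1, 0), (-1, 0), (0, 1), (0, -1)}"

text \<open>
  In \<open>\<langle>t, s | s\<^sup>2, t s t\<^sup>-\<^sup>1 s\<rangle> = \<int> \<times> \<int>/2\<int>\<close>, the generator \<open>t\<close> is \<open>(1, 0)\<close> and \<open>s\<close> is \<open>(0, 1)\<close>.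
\<close>

definition ladder_group :: "(int \<times> int) monoid" where
  "ladder_group = integer_group \<times>\<times> integer_mod_group 2"

definition ladder_gens :: "(int \<times> int) set" where
  "ladder_gens = {(1, 0), (-1, 0), (0, 1)}"

datatype coxeter_gen = A | B | C

definition coxeter_A2_relators :: "(coxeter_gen \<times> bool) list set" where
  "coxeter_A2_relators =
     (let a = (A, False); b = (B, False); c = (C, False)
      in {[a, a], [b, b], [c, c],
          [a, b, a, b, a, b], [a, c, a, c, a, c], [b, c, b, c, b, c]})"

definition hexagonal_grid_group :: "(coxeter_gen \<times> bool) list set monoid" where
  "hexagonal_grid_group = presented_group coxeter_A2_relators"

definition hexagonal_grid_gens :: "(coxeter_gen \<times> bool) list set set" where
  "hexagonal_grid_gens = range (pres_gen coxeter_A2_relators)"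

lemma square_grid_symmetric_generating_set:
  "group square_grid_group" "symmetric_generating_set square_grid_group square_grid_gens"
proof -
  show G: "group square_grid_group"
    by (simp add: square_grid_group_def DirProd_group)
  let ?H = "generate square_grid_group square_grid_gens"
  have mult: "(x, y) \<otimes>\<^bsub>square_grid_group\<^esub> (x', y') = (x + x', y + y')" for x y x' y'
    by (simp add: square_grid_group_def)
  have step: "(x, y) \<in> ?H \<Longrightarrow> (u, v) \<in> square_grid_gens \<Longrightarrow> (x + u, y + v) \<in> ?H" for x y u v
    using generate.eng[OF _ generate.incl] mult by metis
  have zero: "(0, 0) \<in> ?H"
    using generate.one[of square_grid_group] by (simp add: square_grid_group_def)
  have row: "(x, 0) \<in> ?H" for x
  proof (induction x rule: int_induct[where k = 0])
    case (step1 i)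
    then show ?case using step[of i 0 1 0] by (simp add: square_grid_gens_def)
  next
    case (step2 i)
    then show ?case using step[of i 0 "-1" 0] by (simp add: square_grid_gens_def)
  qed (rule zero)
  have "(x, y) \<in> ?H" for x y
  proof (induction y rule: int_induct[where k = 0])
    case (step1 i)
    then show ?case using step[of x i 0 1] by (simp add: square_grid_gens_def)
  next
    case (step2 i)
    then show ?case using step[of x i 0 "-1"] by (simp add: square_grid_gens_def)
  qed (rule row)
  then have "?H = carrier square_grid_group"
    by (auto simp: square_grid_group_def)
  then show "symmetric_generating_set square_grid_group square_grid_gens"
    by (auto simp: symmetric_generating_set_def square_grid_gens_def square_grid_group_def)
qed

lemma ladder_symmetric_generating_set:
  "group ladder_group" "symmetric_generating_set ladder_group ladder_gens"
proof -
  show G: "group ladder_group"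
    by (simp add: ladder_group_def DirProd_group)
  let ?H = "generate ladder_group ladder_gens"
  have mult: "(x, y) \<otimes>\<^bsub>ladder_group\<^esub> (x', y') = (x + x', (y + y') mod 2)" for x y x' y'
    by (simp add: ladder_group_def)
  have step: "(x, y) \<in> ?H \<Longrightarrow> (u, v) \<in> ladder_gens \<Longrightarrow> (x + u, (y + v) mod 2) \<in> ?H" for x y u v
    using generate.eng[OF _ generate.incl] mult by metis
  have zero: "(0, 0) \<in> ?H"
    using generate.one[of ladder_group] by (simp add: ladder_group_def)
  have row: "(x, 0) \<in> ?H" for x
  proof (induction x rule: int_induct[where k = 0])
    case (step1 i)
    then show ?case using step[of i 0 1 0] by (simp add: ladder_gens_def)
  next
    case (step2 i)
    then show ?case using step[of i 0 "-1" 0] by (simp add: ladder_gens_def)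
  qed (rule zero)
  have row1: "(x, 1) \<in> ?H" for x
  proof -
    have "(0, 1) \<in> ladder_gens" by (simp add: ladder_gens_def)
    from step[OF row[of x] this] show ?thesis by simp
  qed
  have carr: "carrier ladder_group = UNIV \<times> {0, 1}"
    by (auto simp: ladder_group_def carrier_integer_mod_group)
  have "?H \<subseteq> carrier ladder_group"
    by (rule group.generate_incl[OF G]) (auto simp: carr ladder_gens_def)
  with row row1 have "?H = carrier ladder_group"
    by (auto simp: carr)
  moreover have "inv\<^bsub>ladder_group\<^esub> p \<in> ladder_gens" if "p \<in> ladder_gens" for p
  proof -
    have "inv\<^bsub>ladder_group\<^esub> (x, y) = (- x, (- y) mod 2)" if "y \<in> {0, 1}" for x y
      unfolding ladder_group_def
      using that by (subst inv_DirProd) (auto simp: carrier_integer_mod_group)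
    then show ?thesis using that by (auto simp: ladder_gens_def)
  qed
  moreover have "finite ladder_gens" "ladder_gens \<subseteq> carrier ladder_group"
    by (auto simp: ladder_gens_def carr)
  moreover have "\<one>\<^bsub>ladder_group\<^esub> \<notin> ladder_gens"
    by (simp add: ladder_gens_def ladder_group_def)
  ultimately show "symmetric_generating_set ladder_group ladder_gens"
    unfolding symmetric_generating_set_def by blast
qed

lemma coxeter_A2_pres_eq_parity:
  "pres_eq coxeter_A2_relators u v \<Longrightarrow> even (length u) \<longleftrightarrow> even (length v)"
  by (induction rule: pres_eq.induct) (auto simp: coxeter_A2_relators_def Let_def)

lemma hexagonal_grid_symmetric_generating_set:
  "group hexagonal_grid_group" "symmetric_generating_set hexagonal_grid_group hexagonal_grid_gens"
proof -
  let ?R = coxeter_A2_relators and ?G = hexagonal_grid_group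
  show G: "group ?G"
    by (simp add: hexagonal_grid_group_def group_presented_group)
  have mult: "pres_class ?R u \<otimes>\<^bsub>?G\<^esub> pres_class ?R v = pres_class ?R (u @ v)" for u v
    by (simp add: hexagonal_grid_group_def mult_presented_group)
  have one: "\<one>\<^bsub>?G\<^esub> = pres_class ?R []"
    by (simp add: hexagonal_grid_group_def one_presented_group)
  have carr: "carrier ?G = range (pres_class ?R)"
    by (simp add: hexagonal_grid_group_def carrier_presented_group)
  have sq: "pres_eq ?R [(x, False), (x, False)] []" for x
    using pres_eq.relator[of "[(x, False), (x, False)]" ?R "[]" "[]"]
    by (cases x) (auto simp: coxeter_A2_relators_def Let_def)
  have inv: "inv\<^bsub>?G\<^esub> pres_gen ?R x = pres_gen ?R x" for x
    by (rule group.inv_equality[OF G])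
      (auto simp: pres_gen_def mult one carr pres_class_eq_iff sq)
  have inv_letter: "pres_class ?R [(x, e)] = pres_gen ?R x" for x e
  proof (cases e)
    case True
    have "pres_class ?R [(x, True)] = inv\<^bsub>?G\<^esub> pres_gen ?R x"
      using pres_eq.cancel[of ?R "[]" x True "[]"]
      by (intro group.inv_equality[OF G, symmetric])
        (auto simp: pres_gen_def mult one carr pres_class_eq_iff)
    then show ?thesis using True inv by simp
  qed (simp add: pres_gen_def)
  have "pres_class ?R u \<in> generate ?G hexagonal_grid_gens" for u
  proof (induction u)
    case Nil
    then show ?case using generate.one[of ?G] one by simp
  next
    case (Cons l u)
    have "pres_class ?R [l] \<in> hexagonal_grid_gens"
      by (cases l) (simp add: inv_letter hexagonal_grid_gens_def)
    from generate.eng[OF generate.incl[OF this] Cons.IH] show ?case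
      by (simp add: mult)
  qed
  moreover have sub: "hexagonal_grid_gens \<subseteq> carrier ?G"
    by (auto simp: hexagonal_grid_gens_def pres_gen_def carr)
  ultimately have "generate ?G hexagonal_grid_gens = carrier ?G"
    using group.generate_incl[OF G sub] by (auto simp: carr)
  moreover have "\<one>\<^bsub>?G\<^esub> \<notin> hexagonal_grid_gens"
    using coxeter_A2_pres_eq_parity
    by (fastforce simp: hexagonal_grid_gens_def pres_gen_def one pres_class_eq_iff)
  moreover have "(UNIV :: coxeter_gen set) = {A, B, C}"
    using coxeter_gen.exhaust by blast
  then have "finite (UNIV :: coxeter_gen set)"
    by (rule ssubst) simp
  then have "finite hexagonal_grid_gens"
    unfolding hexagonal_grid_gens_def by (rule finite_imageI)
  ultimately show "symmetric_generating_set ?G hexagonal_grid_gens"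
    using sub by (auto simp: symmetric_generating_set_def hexagonal_grid_gens_def inv)
qed

end

theory Submission
  imports Defs
begin

text \<open>
  In each case the number of geodesics of length \<open>n\<close> lies between \<open>\<mu> ^ n\<close> and
  \<open>C * (n + 1) * \<mu> ^ n\<close>. In the square grid a geodesic uses two of the four directions; in the
  ladder it goes in one direction and changes sides at most once. In the hexagonal grid, steps at
  even times and steps at odd times go along disjoint sets of the three directions, since
  steps of the same parity can be permuted until two opposite ones cancel. Hence a geodesic has on
  average at most two choices every two steps. Conversely, a path that takes two fixed directions at
  even times and the third one at odd times climbs as fast as possible and is geodesic.
\<close>

section \<open>From sphere sizes to the connective constant\<close>

lemma card_lists_length_le:
  assumes "finite S" "X \<subseteq> lists S"
  shows "finite {w \<in> X. length w = n}"
    and "finite {w \<in> X. length w \<le> n}"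
    and "card {w \<in> X. length w \<le> n} = (\<Sum>m\<le>n. card {w \<in> X. length w = m})"
proof -
  show fin: "finite {w \<in> X. length w = n}" for n
    by (rule finite_subset[OF _ finite_lists_length_eq[OF assms(1), of n]]) (use assms(2) in auto)
  have eq: "{w \<in> X. length w \<le> n} = (\<Union>m\<in>{..n}. {w \<in> X. length w = m})"
    by auto
  then show "finite {w \<in> X. length w \<le> n}"
    using fin by auto
  show "card {w \<in> X. length w \<le> n} = (\<Sum>m\<le>n. card {w \<in> X. length w = m})"
    unfolding eq by (rule card_UN_disjoint) (use fin in auto)
qed

text \<open>Constant and polynomial factors have n-th roots tending to 1, so only the base
  \<open>L\<close> survives in the limit.\<close>

lemma root_tendsto_of_bounds:
  fixes f :: "nat \<Rightarrow> real" and c C L :: real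
  assumes "0 < c" "0 < C" "0 < L"
    and lower: "\<And>n. c * L ^ n \<le> f n"
    and upper: "\<And>n. f n \<le> C * (real n + 1) ^ 2 * L ^ n"
  shows "(\<lambda>n. root n (f n)) \<longlonglongrightarrow> L"
proof (rule tendsto_sandwich)
  \<comment> \<open>\<open>root 0\<close> is constantly 0, so the bounds on the roots are only
    claimed eventually.\<close>
  have rL: "root n (x * L ^ n) = root n x * L" if "0 < n" for n x
    using that \<open>0 < L\<close> by (simp add: real_root_mult real_root_power_cancel)
  show "\<forall>\<^sub>F n in sequentially. root n c * L \<le> root n (f n)"
    using eventually_gt_at_top[of 0]
  proof eventually_elim
    case (elim n)
    then show ?case
      using real_root_le_mono[OF elim lower[of n]] rL[OF elim] by simp
  qed
  show "(\<lambda>n. root n c * L) \<longlonglongrightarrow> L"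
    using tendsto_mult_right[OF LIMSEQ_root_const[OF \<open>0 < c\<close>], of L] by simp
  show "\<forall>\<^sub>F n in sequentially. root n (f n) \<le> root n (4 * C) * (root n (real n)) ^ 2 * L"
    using eventually_gt_at_top[of 0]
  proof eventually_elim
    case (elim n)
    \<comment> \<open>Replacing \<open>n + 1\<close> by \<open>2 * n\<close> costs the factor 4 and
      leaves \<open>root n n\<close>, whose limit is known.\<close>
    have "(real n + 1) ^ 2 \<le> (2 * real n) ^ 2"
      using elim by (intro power_mono) auto
    then have "C * (real n + 1) ^ 2 * L ^ n \<le> C * (2 * real n) ^ 2 * L ^ n"
      using \<open>0 < C\<close> \<open>0 < L\<close> by (intro mult_right_mono mult_left_mono) auto
    then have "f n \<le> (4 * C * real n ^ 2) * L ^ n"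
      using upper[of n] by (simp add: power_mult_distrib)
    from real_root_le_mono[OF elim this] show ?case
      unfolding rL[OF elim] using elim by (simp add: real_root_mult real_root_power)
  qed
  have "(\<lambda>n. root n (4 * C) * (root n (real n)) ^ 2 * L) \<longlonglongrightarrow> 1 * 1 ^ 2 * L"
    using \<open>0 < C\<close> by (intro tendsto_intros LIMSEQ_root_const LIMSEQ_root) auto
  then show "(\<lambda>n. root n (4 * C) * (root n (real n)) ^ 2 * L) \<longlonglongrightarrow> L"
    by simp
qed

text \<open>A ball contains the sphere of the same radius and is the union of \<open>n + 1\<close>
  spheres. As \<open>1 \<le> L\<close>, the bound for the outermost sphere serves for all of them,
  and the sum only adds a factor \<open>n + 1\<close>.\<close>

lemma geodesic_connective_constant_eqI:
  fixes c C L :: real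
  assumes "finite S" "0 < c" "0 < C" "1 \<le> L"
    and lower: "\<And>n. c * L ^ n \<le> card {w \<in> geodesics G S. length w = n}"
    and upper: "\<And>n. card {w \<in> geodesics G S. length w = n} \<le> C * (real n + 1) * L ^ n"
  shows "convergent (geodesic_root G S) \<and> geodesic_connective_constant G S = L"
proof -
  have sub: "geodesics G S \<subseteq> lists S"
    by (auto simp: geodesics_def)
  note spheres = card_lists_length_le[OF \<open>finite S\<close> sub]
  have "c * L ^ n \<le> geodesic_growth G S n" for n
  proof -
    have "card {w \<in> geodesics G S. length w = n} \<le> geodesic_growth G S n"
      unfolding geodesic_growth_def by (intro card_mono spheres) auto
    then show ?thesis using lower[of n] by linarith
  qed
  moreover have "geodesic_growth G S n \<le> C * (real n + 1) ^ 2 * L ^ n" for n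
  proof -
    have "geodesic_growth G S n = (\<Sum>m\<le>n. real (card {w \<in> geodesics G S. length w = m}))"
      by (simp add: geodesic_growth_def spheres)
    also have "\<dots> \<le> (\<Sum>m\<le>n. C * (real n + 1) * L ^ n)"
    proof (rule sum_mono)
      fix m assume "m \<in> {..n}"
      then have "C * (real m + 1) * L ^ m \<le> C * (real n + 1) * L ^ n"
        using assms(3,4) by (intro mult_mono power_increasing) auto
      then show "real (card {w \<in> geodesics G S. length w = m}) \<le> C * (real n + 1) * L ^ n"
        using upper[of m] by linarith
    qed
    also have "\<dots> = C * (real n + 1) ^ 2 * L ^ n"
      by (simp add: power2_eq_square algebra_simps)
    finally show ?thesis .
  qed
  ultimately have "geodesic_root G S \<longlonglongrightarrow> L"
    unfolding geodesic_root_def using assms(2-4) by (intro root_tendsto_of_bounds[where c = c and C = C]) auto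
  then show ?thesis
    by (auto simp: geodesic_connective_constant_def limI intro: convergentI)
qed

lemma geodesics_length_le:
  "w \<in> geodesics G S \<Longrightarrow> v \<in> lists S \<Longrightarrow> word_value G v = word_value G w \<Longrightarrow> length w \<le> length v"
  by (auto simp: geodesics_def not_less)


section \<open>The square grid\<close>

lemma word_value_square_grid:
  "word_value square_grid_group w = (sum_list (map fst w), sum_list (map snd w))"
  by (induction w) (auto simp: word_value_def square_grid_group_def)

text \<open>The group is abelian, so a letter and its opposite can be deleted wherever they stand,
  without changing the value.\<close>

lemma square_grid_geodesic_no_cancel:
  assumes "w \<in> geodesics square_grid_group square_grid_gens" "x \<in> set w"
  shows "- x \<notin> set w"
proof
  assume "- x \<in> set w"
  have w: "w \<in> lists square_grid_gens"
    using assms(1) by (auto simp: geodesics_def)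
  \<comment> \<open>No generator is its own inverse, so \<open>- x\<close> is still present after
    one \<open>x\<close> has been removed.\<close>
  then have "x \<noteq> - x"
    using assms(2) by (auto simp: square_grid_gens_def)
  then have mx: "- x \<in> set (remove1 x w)"
    using \<open>- x \<in> set w\<close> by simp
  let ?v = "remove1 (- x) (remove1 x w)"
  have "word_value square_grid_group ?v = word_value square_grid_group w"
    using sum_list_map_remove1[OF assms(2), of fst] sum_list_map_remove1[OF assms(2), of snd]
      sum_list_map_remove1[OF mx, of fst] sum_list_map_remove1[OF mx, of snd]
    by (simp add: word_value_square_grid)
  moreover have "?v \<in> lists square_grid_gens"
    using w set_remove1_subset[of "- x" "remove1 x w"] set_remove1_subset[of x w] by auto
  moreover have "length ?v < length w"
    using length_pos_if_in_set[OF assms(2)] assms(2) mx by (simp add: length_remove1)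
  ultimately show False
    using geodesics_length_le[OF assms(1), of ?v] by (meson not_less)
qed

text \<open>The sum of the two coordinates grows by at most 1 per letter, and by exactly 1 for each
  letter of \<open>w\<close>.\<close>

lemma square_grid_quadrant_geodesic:
  assumes "w \<in> lists {(1, 0), (0, 1)}"
  shows "w \<in> geodesics square_grid_group square_grid_gens"
proof -
  have le: "sum_list (map fst v) + sum_list (map snd v) \<le> int (length v)"
    if "v \<in> lists square_grid_gens" for v
    using that by (induction v) (auto simp: square_grid_gens_def)
  have eq: "sum_list (map fst w) + sum_list (map snd w) = int (length w)"
    using assms by (induction w) auto
  have "w \<in> lists square_grid_gens"
    using assms by (auto simp: square_grid_gens_def)
  then show ?thesis
    using le eq by (fastforce simp: geodesics_def word_value_square_grid)
qed

lemma square_grid_connective_constant: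
  "convergent (geodesic_root square_grid_group square_grid_gens) \<and>
   geodesic_connective_constant square_grid_group square_grid_gens = 2"
proof (rule geodesic_connective_constant_eqI[where c = 1 and C = 4])
  show fin: "finite square_grid_gens"
    by (simp add: square_grid_gens_def)
  \<comment> \<open>The signs in \<open>p\<close> select one horizontal and one vertical
    direction.\<close>
  define quadrant where
    "quadrant p n = {w. set w \<subseteq> {(fst p, 0), (0, snd p)} \<and> length w = n}" for p :: "int \<times> int" and n
  have quadrant: "finite (quadrant p n)" "card (quadrant p n) = 2 ^ n" if "p \<in> {1, -1} \<times> {1, -1}" for p n
    using that by (auto simp: quadrant_def card_lists_length_eq finite_lists_length_eq simp flip: numeral_2_eq_2)
  fix n
  let ?X = "{w \<in> geodesics square_grid_group square_grid_gens. length w = n}"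
  have "finite ?X"
    by (rule card_lists_length_le[OF fin]) (auto simp: geodesics_def)
  moreover have "quadrant (1, 1) n \<subseteq> ?X"
    using square_grid_quadrant_geodesic by (auto simp: quadrant_def)
  ultimately have "2 ^ n \<le> card ?X"
    using card_mono[of ?X "quadrant (1, 1) n"] quadrant(2)[of "(1, 1)" n] by simp
  then have "real (2 ^ n) \<le> real (card ?X)"
    by (simp only: of_nat_le_iff)
  then show "1 * 2 ^ n \<le> real (card ?X)"
    by simp
  have "?X \<subseteq> (\<Union>p\<in>{1, -1} \<times> {1, -1}. quadrant p n)"
  proof
    fix w assume "w \<in> ?X"
    then have w: "w \<in> geodesics square_grid_group square_grid_gens" "length w = n"
      by auto
    let ?p = "(if (1, 0) \<in> set w then 1 else -1, if (0, 1) \<in> set w then 1 else -1) :: int \<times> int"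
    have "set w \<subseteq> square_grid_gens"
      using w(1) by (auto simp: geodesics_def)
    then have "w \<in> quadrant ?p n"
      using square_grid_geodesic_no_cancel[OF w(1), of "(1, 0)"]
        square_grid_geodesic_no_cancel[OF w(1), of "(0, 1)"] w(2)
      by (auto simp: quadrant_def square_grid_gens_def)
    moreover have "?p \<in> {1, -1} \<times> {1, -1}"
      by auto
    ultimately show "w \<in> (\<Union>p\<in>{1, -1} \<times> {1, -1}. quadrant p n)"
      by blast
  qed
  then have "card ?X \<le> card (\<Union>p\<in>{1, -1} \<times> {1, -1}. quadrant p n)"
    using quadrant(1) by (intro card_mono) blast+
  also have "\<dots> \<le> (\<Sum>p\<in>{1, -1} \<times> {1, -1}. card (quadrant p n))"
    by (rule card_UN_le) simp
  also have "\<dots> = 4 * 2 ^ n"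
    using quadrant(2) by simp
  finally have "real (card ?X) \<le> real (4 * 2 ^ n)"
    by (simp only: of_nat_le_iff)
  also have "\<dots> \<le> 4 * (real n + 1) * 2 ^ n"
    by (simp add: algebra_simps)
  finally show "real (card ?X) \<le> 4 * (real n + 1) * 2 ^ n" .
qed simp_all


section \<open>The ladder\<close>

lemma word_value_ladder:
  "word_value ladder_group w = (sum_list (map fst w), sum_list (map snd w) mod 2)"
  by (induction w) (auto simp: word_value_def ladder_group_def mod_simps)

text \<open>Again the group is abelian, so two letters with trivial product can be deleted. Taking
  \<open>y\<close> from \<open>remove1 x w\<close> ensures two different positions and so covers two
  copies of \<open>s\<close>.\<close>

lemma ladder_geodesic_remove2:
  assumes w: "w \<in> geodesics ladder_group ladder_gens"
    and x: "x \<in> set w" and y: "y \<in> set (remove1 x w)"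
  shows "fst x + fst y \<noteq> 0 \<or> odd (snd x + snd y)"
proof (rule ccontr)
  assume cancel: "\<not> ?thesis"
  let ?v = "remove1 y (remove1 x w)"
  have "word_value ladder_group ?v = word_value ladder_group w"
  proof -
    have "sum_list (map snd w) = (snd x + snd y) + sum_list (map snd ?v)"
      using sum_list_map_remove1[OF x, of snd] sum_list_map_remove1[OF y, of snd] by simp
    moreover have "sum_list (map fst w) = sum_list (map fst ?v)"
      using sum_list_map_remove1[OF x, of fst] sum_list_map_remove1[OF y, of fst] cancel by simp
    moreover have "(snd x + snd y + a) mod 2 = a mod 2" for a
      using cancel by presburger
    ultimately show ?thesis
      by (simp add: word_value_ladder)
  qed
  moreover have "?v \<in> lists ladder_gens"
    using w set_remove1_subset[of y "remove1 x w"] set_remove1_subset[of x w]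
    by (auto simp: geodesics_def)
  moreover have "length ?v < length w"
    using length_pos_if_in_set[OF x] x y by (simp add: length_remove1)
  ultimately show False
    using geodesics_length_le[OF w, of ?v] by (meson not_less)
qed

lemma ladder_connective_constant:
  "convergent (geodesic_root ladder_group ladder_gens) \<and>
   geodesic_connective_constant ladder_group ladder_gens = 1"
proof (rule geodesic_connective_constant_eqI[where c = 1 and C = 2])
  show fin: "finite ladder_gens"
    by (simp add: ladder_gens_def)
  fix n
  let ?X = "{w \<in> geodesics ladder_group ladder_gens. length w = n}"
  have "finite ?X"
    by (rule card_lists_length_le[OF fin]) (auto simp: geodesics_def)
  moreover have "replicate n (1, 0) \<in> ?X"
  proof -
    have le: "sum_list (map fst v) \<le> int (length v)" if "v \<in> lists ladder_gens" for v
      using that by (induction v) (auto simp: ladder_gens_def)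
    show ?thesis
      using le by (fastforce simp: geodesics_def word_value_ladder ladder_gens_def sum_list_replicate)
  qed
  ultimately have "0 < card ?X"
    by (auto simp: card_gt_0_iff)
  then show "1 * 1 ^ n \<le> real (card ?X)"
    by simp
  \<comment> \<open>The index \<open>i\<close> is the position of the letter \<open>s\<close>;
    \<open>i = n\<close> lies beyond the list, where the update has no effect, and encodes its
    absence.\<close>
  let ?word = "\<lambda>(x, i). (replicate n x)[i := (0, 1)] :: (int \<times> int) list"
  have "?X \<subseteq> ?word ` ({(1, 0), (-1, 0)} \<times> {..n})"
  proof
    fix w assume "w \<in> ?X"
    then have w: "w \<in> geodesics ladder_group ladder_gens" "length w = n"
      by auto
    have gens: "set w \<subseteq> {(1, 0), (-1, 0), (0, 1)}"
      using w(1) by (auto simp: geodesics_def ladder_gens_def)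
    define x :: "int \<times> int" where "x = (if (1, 0) \<in> set w then (1, 0) else (-1, 0))"
    have letter: "y = x \<or> y = (0, 1)" if "y \<in> set w" for y
      using that gens ladder_geodesic_remove2[OF w(1), of "(1, 0)" "(-1, 0)"]
      by (auto simp: x_def)
    have "\<exists>i\<le>n. w = (replicate n x)[i := (0, 1)]"
    proof (cases "(0, 1) \<in> set w")
      case False
      then have "w = replicate n x"
        using letter w(2) by (intro replicate_eqI) auto
      then show ?thesis
        by (intro exI[of _ n]) (simp add: list_update_beyond)
    next
      case True
      then obtain u v where uv: "w = u @ (0, 1) # v" "(0, 1) \<notin> set u"
        by (meson split_list_first)
      then have "(0, 1) \<notin> set v"
        using ladder_geodesic_remove2[OF w(1), of "(0, 1)" "(0, 1)"] by (auto simp: remove1_append)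
      then have "u = replicate (length u) x" "v = replicate (length v) x"
        using letter uv by (auto intro!: replicate_eqI)
      moreover have n: "n = length u + Suc (length v)"
        using uv w(2) by simp
      then have "replicate n x = replicate (length u) x @ x # replicate (length v) x"
        by (simp only: replicate_add replicate_Suc)
      ultimately have "w = (replicate n x)[length u := (0, 1)]"
        using uv(1) by (metis length_replicate list_update_length)
      then show ?thesis
        using n by (intro exI[of _ "length u"]) simp
    qed
    moreover have "x \<in> {(1, 0), (-1, 0)}"
      by (simp add: x_def)
    ultimately show "w \<in> ?word ` ({(1, 0), (-1, 0)} \<times> {..n})"
      by (auto simp: image_iff)
  qed
  then have "card ?X \<le> card ({(1, 0), (-1, 0)} \<times> {..n} :: ((int \<times> int) \<times> nat) set)"
    by (intro surj_card_le) auto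
  also have "\<dots> = 2 * (n + 1)"
    by (simp add: card_cartesian_product)
  finally have "real (card ?X) \<le> real (2 * (n + 1))"
    by (simp only: of_nat_le_iff)
  then show "real (card ?X) \<le> 2 * (real n + 1) * 1 ^ n"
    by simp
qed simp_all


section \<open>Words alternating between two alphabets\<close>

fun alternating :: "'a set \<Rightarrow> 'a set \<Rightarrow> nat \<Rightarrow> 'a list set" where
  "alternating P Q 0 = {[]}"
| "alternating P Q (Suc n) = (\<lambda>(x, xs). x # xs) ` (P \<times> alternating Q P n)"

lemma finite_alternating: "finite P \<Longrightarrow> finite Q \<Longrightarrow> finite (alternating P Q n)"
  by (induction n arbitrary: P Q) auto

lemma card_alternating:
  "card (alternating P Q n) = card P ^ ((n + 1) div 2) * card Q ^ (n div 2)"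
proof (induction n arbitrary: P Q)
  case (Suc n)
  have "inj_on (\<lambda>(x, xs). x # xs) (P \<times> alternating Q P n)"
    by (auto simp: inj_on_def)
  then show ?case
    by (simp add: card_image card_cartesian_product Suc.IH)
qed simp

lemma length_alternating: "w \<in> alternating P Q n \<Longrightarrow> length w = n"
  by (induction n arbitrary: P Q w) auto

lemma in_alternatingI:
  "(\<And>k. k < length w \<Longrightarrow> w ! k \<in> (if even k then P else Q)) \<Longrightarrow> w \<in> alternating P Q (length w)"
proof (induction w arbitrary: P Q)
  case (Cons x w)
  have "w \<in> alternating Q P (length w)"
  proof (rule Cons.IH)
    show "w ! k \<in> (if even k then Q else P)" if "k < length w" for k
      using Cons.prems[of "Suc k"] that by (simp split: if_splits)
  qed
  moreover have "x \<in> P"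
    using Cons.prems[of 0] by simp
  ultimately show ?case
    by auto
qed simp


section \<open>The hexagonal grid\<close>

text \<open>
  Embed the grid in the plane so that every edge is parallel to one of three directions, named by
  the same type as the colours. Around each vertex the three colours correspond to the three
  directions in some way \<open>f\<close>, and crossing an edge of colour \<open>x\<close> changes \<open>f\<close> into
  \<open>f \<circ> third x\<close>, because the hexagons alternate between two colours but run through all directions.
  The same rule, applied to the inverse correspondence, leads back, so that \<open>translate id\<close> turns words
  of colours into words of directions and vice versa.
\<close>

fun third :: "coxeter_gen \<Rightarrow> coxeter_gen \<Rightarrow> coxeter_gen" where
  "third A A = A" | "third A B = C" | "third A C = B"
| "third B A = C" | "third B B = B" | "third B C = A"
| "third C A = B" | "third C B = A" | "third C C = C"

lemma third_idem [simp]: "third x x = x"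
  by (cases x) auto

lemma third_third [simp]: "third x (third x y) = y"
  by (cases x; cases y) auto

text \<open>With A, B, C read as 0, 1, 2 in Z/3, \<open>third x y\<close> is -x-y. Both sides become
  -i+j-k-x; the next two identities are linear in the same way.\<close>

lemma third_rotate: "third i (third j (third k x)) = third k (third j (third i x))"
  by (cases i; cases j; cases k; cases x) auto

text \<open>Each map \<open>third x\<close> is an automorphism of the operation
  \<open>third\<close>. This keeps the second hypothesis of \<open>translate_translate\<close>
  invariant along a path.\<close>

lemma third_conjugate: "third (third x y) (third x z) = third x (third y z)"
  by (cases x; cases y; cases z) auto

lemma third_braid: "third x (third y (third x (third y (third x (third y z))))) = z"
  by (cases x; cases y; cases z) auto

lemma UNIV_coxeter_gen: "UNIV = {A, B, C}"
  using coxeter_gen.exhaust by blast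

fun translate :: "(coxeter_gen \<Rightarrow> coxeter_gen) \<Rightarrow> coxeter_gen list \<Rightarrow> coxeter_gen list" where
  "translate f [] = []"
| "translate f (x # w) = f x # translate (f \<circ> third x) w"

lemma length_translate [simp]: "length (translate f w) = length w"
  by (induction w arbitrary: f) auto

text \<open>The correspondence reached at the end of \<open>w\<close> when starting with
  \<open>f\<close>.\<close>

definition frame :: "(coxeter_gen \<Rightarrow> coxeter_gen) \<Rightarrow> coxeter_gen list \<Rightarrow> coxeter_gen \<Rightarrow> coxeter_gen" where
  "frame f w = foldl (\<lambda>g x. g \<circ> third x) f w"

lemma translate_append: "translate f (u @ v) = translate f u @ translate (frame f u) v"
  by (induction u arbitrary: f) (auto simp: frame_def)

text \<open>After the letter \<open>x\<close> the inner map is \<open>g \<circ> third x\<close> and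
  the outer one \<open>f \<circ> third (g x)\<close>. They are again inverse to each other, because
  \<open>g\<close> commutes with the operation \<open>third\<close>.\<close>

lemma translate_translate:
  assumes "\<And>x. f (g x) = x" and "\<And>x y. g (third x y) = third (g x) (g y)"
  shows "translate f (translate g w) = w"
  using assms
proof (induction w arbitrary: f g)
  case (Cons x w)
  have "translate (f \<circ> third (g x)) (translate (g \<circ> third x) w) = w"
  proof (rule Cons.IH)
    show "(f \<circ> third (g x)) ((g \<circ> third x) y) = y" for y
      using Cons.prems by simp
    show "(g \<circ> third x) (third y z) = third ((g \<circ> third x) y) ((g \<circ> third x) z)" for y z
      using Cons.prems(2) by (simp add: third_conjugate)
  qed
  then show ?case
    using Cons.prems(1) by simp
qed simp

lemma translate_id_involution: "translate id (translate id w) = w"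
  by (rule translate_translate) auto

section \<open>Words of colours modulo the Coxeter relators\<close>

definition coxeter_eq :: "coxeter_gen list \<Rightarrow> coxeter_gen list \<Rightarrow> bool" where
  "coxeter_eq u v \<longleftrightarrow> pres_eq coxeter_A2_relators (map (\<lambda>x. (x, False)) u) (map (\<lambda>x. (x, False)) v)"

lemma coxeter_eq_refl: "coxeter_eq u u"
  by (simp add: coxeter_eq_def pres_eq.refl)

lemma coxeter_eq_sym: "coxeter_eq u v \<Longrightarrow> coxeter_eq v u"
  by (simp add: coxeter_eq_def pres_eq.sym)

lemma coxeter_eq_trans: "coxeter_eq u v \<Longrightarrow> coxeter_eq v w \<Longrightarrow> coxeter_eq u w"
  unfolding coxeter_eq_def by (rule pres_eq.trans)

lemma coxeter_eq_append: "coxeter_eq u u' \<Longrightarrow> coxeter_eq v v' \<Longrightarrow> coxeter_eq (u @ v) (u' @ v')"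
  by (simp add: coxeter_eq_def pres_eq_append)

lemma coxeter_eq_square: "coxeter_eq [x, x] []"
  using pres_eq.relator[of "[(x, False), (x, False)]" coxeter_A2_relators "[]" "[]"]
  by (cases x) (auto simp: coxeter_A2_relators_def coxeter_eq_def Let_def)

text \<open>The letters are involutions, so \<open>rev v\<close> represents the inverse of
  \<open>v\<close>.\<close>

lemma coxeter_eq_append_inverse:
  assumes "coxeter_eq (u @ v) []"
  shows "coxeter_eq u (rev v)"
proof -
  have "coxeter_eq (v @ rev v) []"
  proof (induction v)
    case (Cons x v)
    have "coxeter_eq ([x] @ (v @ rev v) @ [x]) ([x] @ [] @ [x])"
      by (intro coxeter_eq_append coxeter_eq_refl Cons.IH)
    from coxeter_eq_trans[OF this] show ?case
      by (simp add: coxeter_eq_square)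
  qed (simp add: coxeter_eq_refl)
  then have "coxeter_eq (u @ v @ rev v) (u @ [])"
    by (rule coxeter_eq_append[OF coxeter_eq_refl])
  from coxeter_eq_sym[OF this] have "coxeter_eq u ((u @ v) @ rev v)"
    by simp
  moreover have "coxeter_eq ((u @ v) @ rev v) ([] @ rev v)"
    by (intro coxeter_eq_append coxeter_eq_refl assms)
  ultimately have "coxeter_eq u ([] @ rev v)"
    by (rule coxeter_eq_trans)
  then show ?thesis
    by simp
qed

text \<open>The hexagon relator is cut into two halves of three letters; the relators list only one
  order of each pair, the other follows by symmetry.\<close>

lemma coxeter_eq_braid: "coxeter_eq [x, y, x] [y, x, y]"
proof (cases "x = y")
  case False
  have rel: "coxeter_eq ([u, v, u] @ [v, u, v]) []" if "(u, v) \<in> {(A, B), (A, C), (B, C)}" for u v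
    using pres_eq.relator[of "map (\<lambda>z. (z, False)) [u, v, u, v, u, v]" coxeter_A2_relators "[]" "[]"] that
    by (auto simp: coxeter_A2_relators_def coxeter_eq_def Let_def)
  have "coxeter_eq [u, v, u] [v, u, v]" if "(u, v) \<in> {(A, B), (A, C), (B, C)}" for u v
    using coxeter_eq_append_inverse[OF rel[OF that]] by simp
  moreover have "(x, y) \<in> {(A, B), (A, C), (B, C)} \<or> (y, x) \<in> {(A, B), (A, C), (B, C)}"
    using False by (cases x; cases y) auto
  ultimately show ?thesis
    using coxeter_eq_sym by blast
qed (simp add: coxeter_eq_refl)

section \<open>Shortening paths by permuting directions\<close>

text \<open>
  Reversing three consecutive directions leads to the same vertex: either the two paths go around
  the two halves of a hexagon, or a direction is cancelled.
\<close>

lemma coxeter_eq_translate_swap: "coxeter_eq (translate f [i, j, k]) (translate f [k, j, i])"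
proof -
  have cancel: "coxeter_eq [x, x, z] [z, y, y]" for x y z
  proof (rule coxeter_eq_trans)
    show "coxeter_eq [x, x, z] [z]"
      using coxeter_eq_append[OF coxeter_eq_square coxeter_eq_refl[of "[z]"], of x] by simp
    show "coxeter_eq [z] [z, y, y]"
      using coxeter_eq_append[OF coxeter_eq_refl[of "[z]"] coxeter_eq_square, of y]
      by (simp add: coxeter_eq_sym)
  qed
  consider "i = k" | "i = j" "j \<noteq> k" | "j = k" "i \<noteq> j" | "k = third i j" "i \<noteq> j"
    by (cases i; cases j; cases k) auto
  then show ?thesis
  proof cases
    case 1
    then show ?thesis by (simp add: coxeter_eq_refl)
  next
    case 2
    then show ?thesis using cancel by simp
  next
    case 3
    then show ?thesis using coxeter_eq_sym[OF cancel] by simp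
  next
    case 4
    \<comment> \<open>For three distinct directions the colour words are
      \<open>f i, f k, f i\<close> and \<open>f k, f i, f k\<close>, the two sides of a braid
      relation.\<close>
    then have "third i (third j k) = i" "third k j = i" "third k (third j i) = k"
      by (cases i; cases j; auto)+
    then show ?thesis
      using coxeter_eq_braid 4(1) by simp
  qed
qed

text \<open>The tail \<open>v\<close> is read in the frame reached before it, so \<open>p\<close>
  and \<open>q\<close> must lead to the same frame as well as to the same vertex.\<close>

lemma coxeter_eq_translate_context:
  assumes "coxeter_eq (translate (frame f u) p) (translate (frame f u) q)"
    and "\<And>g. frame g p = frame g q"
  shows "coxeter_eq (translate f (u @ p @ v)) (translate f (u @ q @ v))"
  using assms by (simp add: translate_append coxeter_eq_append coxeter_eq_refl)

text \<open>Each swap of three directions moves the second \<open>i\<close> two places to the left.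
  As the gap is even, the two finally become adjacent, where they traverse the same edge back and
  forth and cancel.\<close>

lemma coxeter_eq_translate_shorten:
  assumes "even (length m)"
  shows "\<exists>w. length w < length (u @ i # m @ i # v) \<and>
             coxeter_eq (translate f (u @ i # m @ i # v)) (translate f w)"
  using assms
proof (induction "length m" arbitrary: m v rule: less_induct)
  case less
  show ?case
  proof (cases m rule: rev_cases)
    case Nil
    have "coxeter_eq (translate f (u @ [i, i] @ v)) (translate f (u @ [] @ v))"
      by (rule coxeter_eq_translate_context) (auto simp: frame_def coxeter_eq_square)
    then show ?thesis
      using Nil by (intro exI[of _ "u @ v"]) simp
  next
    case (snoc m' k)
    then obtain m'' j where m: "m = m'' @ [j, k]"
      using less.prems by (cases m' rule: rev_cases) auto
    have "coxeter_eq (translate f ((u @ i # m'') @ [j, k, i] @ v)) (translate f ((u @ i # m'') @ [i, k, j] @ v))"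
      by (intro coxeter_eq_translate_context coxeter_eq_translate_swap)
        (auto simp: frame_def third_rotate)
    then have swap: "coxeter_eq (translate f (u @ i # m @ i # v)) (translate f (u @ i # m'' @ i # k # j # v))"
      by (simp add: m)
    obtain w where "length w < length (u @ i # m'' @ i # (k # j # v))"
      and w: "coxeter_eq (translate f (u @ i # m'' @ i # (k # j # v))) (translate f w)"
      using less.hyps[of m'' "k # j # v"] less.prems m by auto
    then have "length w < length (u @ i # m @ i # v)"
      by (simp add: m)
    then show ?thesis
      using coxeter_eq_trans[OF swap w] by blast
  qed
qed

section \<open>Geodesics of the hexagonal grid and the upper bound\<close>

lemma word_value_hexagonal_grid:
  "word_value hexagonal_grid_group (map (pres_gen coxeter_A2_relators) w) =
   pres_class coxeter_A2_relators (map (\<lambda>x. (x, False)) w)"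
proof (induction w)
  case (Cons x w)
  then show ?case
    using mult_presented_group[of coxeter_A2_relators "[(x, False)]"]
    by (simp add: word_value_def hexagonal_grid_group_def pres_gen_def)
qed (simp add: word_value_def hexagonal_grid_group_def one_presented_group)

lemma hexagonal_grid_geodesics:
  "map (pres_gen coxeter_A2_relators) w \<in> geodesics hexagonal_grid_group hexagonal_grid_gens \<longleftrightarrow>
   (\<forall>v. coxeter_eq v w \<longrightarrow> length w \<le> length v)"
proof -
  have "lists hexagonal_grid_gens = range (map (pres_gen coxeter_A2_relators))"
    by (simp add: hexagonal_grid_gens_def lists_image)
  then show ?thesis
    by (auto simp: geodesics_def word_value_hexagonal_grid pres_class_eq_iff coxeter_eq_def not_less)
qed

text \<open>Positions of opposite parity enclose an even number of letters, so a direction common to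
  both would allow shortening.\<close>

lemma hexagonal_grid_geodesic_directions_disjoint:
  assumes "\<And>v. coxeter_eq v (translate id w) \<Longrightarrow> length w \<le> length v"
    and "k < length w" "l < length w" "even k" "odd l"
  shows "w ! k \<noteq> w ! l"
proof
  assume eq: "w ! k = w ! l"
  have False if "k < l" "l < length w" "w ! k = w ! l" "odd (l - k)" for k l
  proof -
    let ?m = "take (l - Suc k) (drop (Suc k) w)"
    have "w = take k w @ w ! k # drop (Suc k) w"
      using that by (intro id_take_nth_drop) simp
    also have "drop (Suc k) w = ?m @ w ! l # drop (Suc l) w"
      using that id_take_nth_drop[of "l - Suc k" "drop (Suc k) w"] by simp
    finally have w: "w = take k w @ w ! k # ?m @ w ! k # drop (Suc l) w"
      using that by simp
    have "even (length ?m)"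
      using that by simp
    from coxeter_eq_translate_shorten[OF this, of "take k w" "w ! k" "drop (Suc l) w" id]
    obtain v where "length v < length w" "coxeter_eq (translate id w) (translate id v)"
      unfolding w[symmetric] by blast
    then show False
      using assms(1)[of "translate id v"] coxeter_eq_sym by auto
  qed
  from this[of k l] this[of l k] show False
    using assms(2-) eq by (cases k l rule: linorder_cases) auto
qed

text \<open>The constant is 64 * 3: there are 8 * 8 pairs of sets of directions, and for odd
  \<open>n\<close> one letter remains outside the pairs of consecutive letters, with at most 3
  choices.\<close>

lemma hexagonal_grid_sphere_upper:
  "card {w \<in> geodesics hexagonal_grid_group hexagonal_grid_gens. length w = n} \<le> 192 * 2 ^ (n div 2)"
proof -
  let ?gen = "pres_gen coxeter_A2_relators"
  let ?disjoint = "{(P, Q). P \<inter> Q = ({} :: coxeter_gen set)}"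
  let ?words = "\<lambda>(P, Q). alternating P Q n"
  have fin: "finite (X :: coxeter_gen set)" for X
    by (rule finite_subset[OF subset_UNIV]) (simp add: UNIV_coxeter_gen)
  have fin_disjoint: "finite ?disjoint"
    by (rule finite_subset[of _ "Pow UNIV \<times> Pow UNIV"]) (auto simp: fin simp del: Pow_UNIV)
  have card_words: "card (?words p) \<le> 3 * 2 ^ (n div 2)" if "p \<in> ?disjoint" for p
  proof -
    obtain P Q where p: "p = (P, Q)" "P \<inter> Q = {}"
      using \<open>p \<in> ?disjoint\<close> by auto
    have card3: "card X \<le> 3" for X :: "coxeter_gen set"
    proof -
      have "card X \<le> card (UNIV :: coxeter_gen set)"
        by (intro card_mono fin subset_UNIV)
      then show ?thesis
        by (simp add: UNIV_coxeter_gen)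
    qed
    have "card P + card Q \<le> 3"
      using card_Un_disjoint[OF fin fin p(2)] card3[of "P \<union> Q"] by simp
    then have "card P \<in> {0, 1, 2, 3} \<and> card Q \<in> {0, 1, 2, 3} \<and> card P + card Q \<le> 3"
      by auto
    \<comment> \<open>Two sizes with sum at most 3 have product at most 1 * 2; this is where the
      growth by 2 per two steps comes from.\<close>
    then have PQ: "card P * card Q \<le> 2"
      by auto
    have "(n + 1) div 2 = n div 2 + n mod 2"
      by presburger
    then have "card (?words p) = (card P * card Q) ^ (n div 2) * card P ^ (n mod 2)"
      by (simp add: p card_alternating power_add power_mult_distrib)
    also have "\<dots> \<le> 2 ^ (n div 2) * 3"
      using PQ card3[of P] by (intro mult_mono power_mono) (auto simp: mod2_eq_if)
    finally show ?thesis by simp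
  qed
  have "card ?disjoint \<le> card (Pow UNIV \<times> Pow UNIV :: (coxeter_gen set \<times> coxeter_gen set) set)"
    by (intro card_mono finite_cartesian_product) (auto simp: fin simp del: Pow_UNIV)
  also have "\<dots> = 64"
    by (simp add: card_cartesian_product card_Pow fin del: Pow_UNIV) (simp add: UNIV_coxeter_gen)
  finally have card_disjoint: "card ?disjoint \<le> 64" .
  have "{w \<in> geodesics hexagonal_grid_group hexagonal_grid_gens. length w = n} \<subseteq>
    (\<lambda>w. map ?gen (translate id w)) ` (\<Union>p\<in>?disjoint. ?words p)"
  proof
    fix x assume x: "x \<in> {w \<in> geodesics hexagonal_grid_group hexagonal_grid_gens. length w = n}"
    then obtain c where c: "x = map ?gen c"
      by (auto simp: geodesics_def hexagonal_grid_gens_def lists_image)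
    define w where "w = translate id c"
    have cw: "c = translate id w"
      by (simp add: w_def translate_id_involution)
    have geo: "length w \<le> length v" if "coxeter_eq v (translate id w)" for v
      using x that hexagonal_grid_geodesics[of c] by (auto simp: c cw)
    let ?P = "{w ! k | k. k < length w \<and> even k}" and ?Q = "{w ! k | k. k < length w \<and> odd k}"
    have "w \<in> alternating ?P ?Q (length w)"
      by (rule in_alternatingI) auto
    moreover have "?P \<inter> ?Q = {}"
      using hexagonal_grid_geodesic_directions_disjoint[OF geo] by fastforce
    moreover have "length w = n"
      using x c cw by simp
    ultimately have "w \<in> (\<Union>p\<in>?disjoint. ?words p)"
      by (intro UN_I[of "(?P, ?Q)"]) auto
    then show "x \<in> (\<lambda>w. map ?gen (translate id w)) ` (\<Union>p\<in>?disjoint. ?words p)"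
      unfolding c cw by (rule imageI)
  qed
  then have "card {w \<in> geodesics hexagonal_grid_group hexagonal_grid_gens. length w = n} \<le>
      card (\<Union>p\<in>?disjoint. ?words p)"
    using fin_disjoint by (intro surj_card_le) (auto simp: finite_alternating fin)
  also have "\<dots> \<le> (\<Sum>p\<in>?disjoint. card (?words p))"
    by (rule card_UN_le[OF fin_disjoint])
  also have "\<dots> \<le> card ?disjoint * (3 * 2 ^ (n div 2))"
    using sum_bounded_above[of ?disjoint "\<lambda>p. card (?words p)", OF card_words] by simp
  also have "\<dots> \<le> 64 * (3 * 2 ^ (n div 2))"
    by (intro mult_le_mono1 card_disjoint)
  finally show ?thesis by simp
qed

section \<open>Height and the lower bound\<close>

text \<open>
  The right action of the group on triples: how the colours correspond to the directions at the
  current vertex, the sign of the vertex in the bipartition, and its height. The height is a linear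
  functional on the plane; the three unit vectors sum to zero, hence so do its values 1, 1, -2.
\<close>

fun height_step :: "coxeter_gen \<Rightarrow> int" where
  "height_step A = 1" | "height_step B = 1" | "height_step C = -2"

fun act :: "(coxeter_gen \<Rightarrow> coxeter_gen) \<times> int \<times> int \<Rightarrow> coxeter_gen \<Rightarrow>
    (coxeter_gen \<Rightarrow> coxeter_gen) \<times> int \<times> int" where
  "act (f, s, z) x = (f \<circ> third x, - s, z + s * height_step (f x))"

text \<open>Thus \<open>act\<close> descends to the group. \<open>map fst\<close> may forget inverse
  marks since every letter acts as an involution: a repeated colour retraces its edge with the
  opposite sign.\<close>

lemma act_respects_relators:
  "pres_eq coxeter_A2_relators u v \<Longrightarrow> foldl act st (map fst u) = foldl act st (map fst v)"
proof (induction arbitrary: st rule: pres_eq.induct)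
  case (cancel u x e v)
  have "act (act st x) x = st" for st
    by (cases st) (auto simp: fun_eq_iff)
  then show ?case
    by simp
next
  case (relator r u v)
  have "foldl act st (map fst r) = st" for st
  proof (cases st)
    case (fields f s z)
    \<comment> \<open>The frame returns after a hexagon. So does the height: the directions repeat
      after three steps while the sign has changed, so opposite sides cancel.\<close>
    have comp: "f \<circ> third x \<circ> third y \<circ> third x \<circ> third y \<circ> third x \<circ> third y = f" for x y
      by (simp add: fun_eq_iff third_braid)
    show ?thesis
      using relator fields by (auto simp: coxeter_A2_relators_def Let_def comp) (auto simp: fun_eq_iff)
  qed
  then show ?case
    by simp
qed auto

lemma coxeter_eq_act: "coxeter_eq u v \<Longrightarrow> foldl act st u = foldl act st v"
  unfolding coxeter_eq_def by (drule act_respects_relators[of _ _ st]) (simp add: comp_def)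

text \<open>A step gains at most 1 at sign 1 and at most 2 at sign -1, hence 3 per two steps.
  Doubling avoids halves, and the last term corrects for an unpaired step.\<close>

lemma height_upper:
  assumes "s = 1 \<or> s = -1"
  shows "2 * snd (snd (foldl act (f, s, z) w)) \<le> 2 * z + 3 * int (length w) - s * int (length w mod 2)"
  using assms
proof (induction w arbitrary: f s z)
  case (Cons x w)
  have "2 * s * height_step (f x) \<le> 3 - s"
    using Cons.prems by (cases "f x") auto
  moreover have "int (length w mod 2) = 1 - int (length (x # w) mod 2)"
    by (simp add: mod_Suc mod2_eq_if)
  ultimately show ?case
    using Cons.IH[of "- s" "f \<circ> third x" "z + s * height_step (f x)"] Cons.prems
    by (auto simp: algebra_simps comp_def)
qed simp

text \<open>Directions A, B at sign 1 and C at sign -1 attain the maximal gain at every step. As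
  \<open>f\<close> undoes \<open>g\<close>, the directions seen by \<open>act\<close> are the
  letters of \<open>w\<close>.\<close>

lemma height_alternating:
  assumes "s = 1 \<or> s = -1"
    and "w \<in> (if s = 1 then alternating {A, B} {C} n else alternating {C} {A, B} n)"
    and "\<And>x. f (g x) = x" and "\<And>x y. g (third x y) = third (g x) (g y)"
  shows "2 * snd (snd (foldl act (f, s, z) (translate g w))) = 2 * z + 3 * int n - s * int (n mod 2)"
  using assms
proof (induction n arbitrary: f g s w z)
  case (Suc n)
  obtain x w' where w: "w = x # w'" and x: "2 * s * height_step x = 3 - s"
    and w': "w' \<in> (if - s = 1 then alternating {A, B} {C} n else alternating {C} {A, B} n)"
    using Suc.prems(1,2) by (auto split: if_splits)
  have "2 * snd (snd (foldl act (f \<circ> third (g x), - s, z + s * height_step x) (translate (g \<circ> third x) w'))) =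
    2 * (z + s * height_step x) + 3 * int n - (- s) * int (n mod 2)"
  proof (rule Suc.IH)
    show "(f \<circ> third (g x)) ((g \<circ> third x) y) = y" for y
      using Suc.prems by simp
    show "(g \<circ> third x) (third y z) = third ((g \<circ> third x) y) ((g \<circ> third x) z)" for y z
      using Suc.prems(4) by (simp add: third_conjugate)
  qed (use Suc.prems(1) w' in auto)
  moreover have "int (n mod 2) = 1 - int (Suc n mod 2)"
    by (simp add: mod_Suc mod2_eq_if)
  ultimately show ?case
    using x Suc.prems(3) by (simp add: w algebra_simps)
next
  case 0
  have "w = []"
    using "0.prems"(2) by (simp split: if_splits)
  then show ?case
    by simp
qed

lemma alternating_geodesic:
  assumes "w \<in> alternating {A, B} {C} n" "coxeter_eq v (translate id w)"
  shows "n \<le> length v"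
proof (rule ccontr)
  assume "\<not> n \<le> length v"
  have "3 * int n - int (n mod 2) = 2 * snd (snd (foldl act (id, 1, 0) v))"
    using height_alternating[of 1 w n id id 0] assms by (simp add: coxeter_eq_act)
  \<comment> \<open>The bound is strictly increasing in the length, so a shorter word cannot reach
    this height.\<close>
  also have "\<dots> \<le> 3 * int (length v) - int (length v mod 2)"
    using height_upper[of 1 id 0 v] by simp
  finally show False
    using \<open>\<not> n \<le> length v\<close> by linarith
qed

text \<open>The generators act on frames by three different transpositions. Hence distinct colour
  words stay distinct when counted as words over the generating set.\<close>

lemma inj_pres_gen_coxeter: "inj (pres_gen coxeter_A2_relators)"
proof (rule injI)
  fix x y assume "pres_gen coxeter_A2_relators x = pres_gen coxeter_A2_relators y"
  then have "coxeter_eq [x] [y]"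
    by (simp add: pres_gen_def pres_class_eq_iff coxeter_eq_def)
  from coxeter_eq_act[OF this, of "(id, 1, 0)"] have "third x y = third y y"
    by simp
  then show "x = y"
    by (cases x; cases y) auto
qed

lemma hexagonal_grid_sphere_lower:
  "2 ^ ((n + 1) div 2) \<le> card {w \<in> geodesics hexagonal_grid_group hexagonal_grid_gens. length w = n}"
proof -
  let ?word = "\<lambda>w. map (pres_gen coxeter_A2_relators) (translate id w)"
  have fin: "finite hexagonal_grid_gens"
    using hexagonal_grid_symmetric_generating_set(2) by (simp add: symmetric_generating_set_def)
  have "inj ?word"
    using inj_pres_gen_coxeter by (metis (mono_tags, lifting) injI inj_map_eq_map translate_id_involution)
  then have "card (?word ` alternating {A, B} {C} n) = card (alternating {A, B} {C} n)"
    by (intro card_image) (auto simp: inj_def inj_on_def)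
  also have "\<dots> = 2 ^ ((n + 1) div 2)"
    by (simp add: card_alternating flip: numeral_2_eq_2)
  finally have "2 ^ ((n + 1) div 2) = card (?word ` alternating {A, B} {C} n)" ..
  also have "\<dots> \<le> card {w \<in> geodesics hexagonal_grid_group hexagonal_grid_gens. length w = n}"
  proof (rule card_mono)
    show "finite {w \<in> geodesics hexagonal_grid_group hexagonal_grid_gens. length w = n}"
      by (rule card_lists_length_le[OF fin]) (auto simp: geodesics_def)
    show "?word ` alternating {A, B} {C} n \<subseteq> {w \<in> geodesics hexagonal_grid_group hexagonal_grid_gens. length w = n}"
      using alternating_geodesic by (auto simp: hexagonal_grid_geodesics length_alternating)
  qed
  finally show ?thesis .
qed

lemma hexagonal_grid_connective_constant:
  "convergent (geodesic_root hexagonal_grid_group hexagonal_grid_gens) \<and>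
   geodesic_connective_constant hexagonal_grid_group hexagonal_grid_gens = sqrt 2"
proof (rule geodesic_connective_constant_eqI[where c = 1 and C = 192])
  show "finite hexagonal_grid_gens"
    using hexagonal_grid_symmetric_generating_set(2) by (simp add: symmetric_generating_set_def)
  have two_power: "2 ^ k = sqrt 2 ^ (2 * k)" for k
    by (simp add: power_mult)
  fix n
  let ?X = "{w \<in> geodesics hexagonal_grid_group hexagonal_grid_gens. length w = n}"
  \<comment> \<open>The exponent \<open>n\<close> lies between twice its half rounded down and twice
    its half rounded up, which gives both bounds.\<close>
  have "sqrt 2 ^ n \<le> sqrt 2 ^ (2 * ((n + 1) div 2))"
    by (intro power_increasing) auto
  also have "\<dots> = real (2 ^ ((n + 1) div 2))"
    by (simp add: two_power)
  also have "\<dots> \<le> real (card ?X)"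
    using hexagonal_grid_sphere_lower by (simp only: of_nat_le_iff)
  finally show "1 * sqrt 2 ^ n \<le> real (card ?X)"
    by simp
  have "real (card ?X) \<le> real (192 * 2 ^ (n div 2))"
    using hexagonal_grid_sphere_upper by (simp only: of_nat_le_iff)
  also have "\<dots> = 192 * 1 * sqrt 2 ^ (2 * (n div 2))"
    by (simp add: two_power)
  also have "\<dots> \<le> 192 * (real n + 1) * sqrt 2 ^ n"
    by (intro mult_mono power_increasing) auto
  finally show "real (card ?X) \<le> 192 * (real n + 1) * sqrt 2 ^ n" .
qed simp_all

theorem proposition7p9:
  shows "(convergent (geodesic_root square_grid_group square_grid_gens) \<and>
          geodesic_connective_constant square_grid_group square_grid_gens = 2) \<and>
         (convergent (geodesic_root ladder_group ladder_gens) \<and>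
          geodesic_connective_constant ladder_group ladder_gens = 1) \<and>
         (convergent (geodesic_root hexagonal_grid_group hexagonal_grid_gens) \<and>
          geodesic_connective_constant hexagonal_grid_group hexagonal_grid_gens = sqrt 2)"
  using square_grid_connective_constant ladder_connective_constant hexagonal_grid_connective_constant
  by blast

end
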